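(* Assume $\operatorname{cov}\mathcal{M}<\mathfrak{c}$. Then for every $s>0$ there exists a separable metric space $X$ with $\dim_H X\ge s$ and cardinality $|X|<\mathfrak{c}$; consequently there is no function (of any kind) from $X$ onto a non-degenerate interval of $\mathbb{R}$.
   Context: $\mathfrak{c}$ is the cardinality of the continuum, $\mathcal{M}$ is the collection of first category (meager) subsets of $\mathbb{R}$, and $\operatorname{cov}\mathcal{M}$ is the least cardinality of a family of first category subsets of $\mathbb{R}$ whose union is $\mathbb{R}$. $\dim_H$ denotes Hausdorff dimension. *)

theory Defs
  imports "HOL-Analysis.Analysis" "HOL-Library.Equipollence"
begin

definition nowhere_dense :: "real set \<Rightarrow> bool" where
  "nowhere_dense N \<longleftrightarrow> interior (closure N) = {}"

definition meager :: "real set \<Rightarrow> bool" where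
  "meager A \<longleftrightarrow> (\<exists>F. countable F \<and> (\<forall>N\<in>F. nowhere_dense N) \<and> A \<subseteq> \<Union>F)"

definition covM_less_continuum :: bool where
  "covM_less_continuum \<longleftrightarrow>
     (\<exists>F::real set set. (\<forall>A\<in>F. meager A) \<and> \<Union>F = UNIV \<and> F \<prec> (UNIV::real set))"

definition hdiam :: "'a metric \<Rightarrow> 'a set \<Rightarrow> real" where
  "hdiam m U = (if U = {} then 0 else Sup {mdist m x y | x y. x \<in> U \<and> y \<in> U})"

definition hausdorff_pre :: "'a metric \<Rightarrow> real \<Rightarrow> real \<Rightarrow> 'a set \<Rightarrow> ennreal" where
  "hausdorff_pre m s \<delta> A =
     (INF U \<in> {U :: nat \<Rightarrow> 'a set. A \<subseteq> (\<Union>n. U n) \<and>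
                 (\<forall>n. U n \<subseteq> mspace m \<and> (\<forall>x\<in>U n. \<forall>y\<in>U n. mdist m x y \<le> \<delta>))}.
        (\<Sum>n. ennreal (hdiam m (U n) powr s)))"

definition hausdorff_measure :: "'a metric \<Rightarrow> real \<Rightarrow> 'a set \<Rightarrow> ennreal" where
  "hausdorff_measure m s A = (SUP \<delta>\<in>{0<..}. hausdorff_pre m s \<delta> A)"

definition hausdorff_dim :: "'a metric \<Rightarrow> ereal" where
  "hausdorff_dim m = Inf (ereal ` {t. 0 < t \<and> hausdorff_measure m t (mspace m) = 0})"

end

theory Submission
  imports Defs
begin

text \<open>
  If every family of fewer than continuum many functions in \<open>\<nat>\<^sup>\<nat>\<close> is met by a single \<open>g\<close> (each
  member agrees with \<open>g\<close> somewhere), then fewer than continuum many nowhere dense sets do not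
  cover the line (Bartoszynski): \<open>g\<close> guesses the strategies that shrink an interval off each of
  them. So \<open>cov \<M> < \<cc>\<close> yields a small family \<open>F\<close> that no \<open>g\<close> meets. Give \<open>F\<close> the distance
  \<open>(k + 1) powr (-1/s)\<close>, where \<open>k\<close> is the first place of difference. If sets \<open>U\<^sub>n\<close>, listed by
  decreasing diameter, have \<open>\<Sum> (diam U\<^sub>n)\<^sup>s < 1\<close>, then \<open>(diam U\<^sub>n)\<^sup>s < 1/(n + 1)\<close>, so all
  members of \<open>U\<^sub>n\<close> agree at \<open>n\<close>; hence a cover of \<open>F\<close> of this kind would define a \<open>g\<close> meeting
  all of \<open>F\<close>.
\<close>

section \<open>Families of size below the continuum\<close>

text \<open>An infinite set absorbs a countable factor, and a finite one gives a countable product.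
  This permits indexing by a function together with a number.\<close>

lemma lesspoll_real_Times_nat:
  assumes "A \<prec> (UNIV :: real set)"
  shows "A \<times> (UNIV :: nat set) \<prec> (UNIV :: real set)"
proof (cases "finite A")
  case True
  then have "countable (A \<times> (UNIV :: nat set))"
    by (simp add: countable_finite)
  then have "A \<times> (UNIV :: nat set) \<lesssim> (UNIV :: nat set)"
    by (auto simp: countable_def lepoll_def)
  also have "(UNIV :: nat set) \<prec> (UNIV :: real set)"
  proof -
    have "(UNIV :: nat set) \<lesssim> (UNIV :: real set)"
      unfolding lepoll_def by (intro exI[of _ real]) (auto simp: inj_def)
    moreover have "\<not> (UNIV :: nat set) \<approx> (UNIV :: real set)"
      using countable_eqpoll[OF _ eqpoll_sym] uncountable_UNIV_real by (metis countableI_type)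
    ultimately show ?thesis
      by (simp add: lepoll_iff_leqpoll)
  qed
  finally show ?thesis .
next
  case False
  then have "(UNIV :: nat set) \<lesssim> A"
    by (simp add: infinite_le_lepoll)
  then have "A \<times> (UNIV :: nat set) \<approx> A"
    using card_of_Times_infinite[of A "UNIV :: nat set"] False
    by (simp add: eqpoll_iff_card_of_ordIso lepoll_def card_of_ordLeq)
  then show ?thesis
    using assms eq_lesspoll_trans by blast
qed

section \<open>Guessing many functions by a single one\<close>

text \<open>One agreement is demanded, not infinitely many, so that a failure yields a small family
  in which every \<open>g\<close> is avoided at all places by some member. The dimension estimate
  needs this form.\<close>

definition guessing_principle :: bool where
  "guessing_principle \<longleftrightarrow>
     (\<forall>F :: (nat \<Rightarrow> nat) set. F \<prec> (UNIV :: real set) \<longrightarrow> (\<exists>g. \<forall>f\<in>F. \<exists>n. f n = g n))"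

text \<open>Coding values as naturals makes it possible to guess a whole finite table of values at
  one place.\<close>

lemma guess_countable:
  fixes u :: "'i \<Rightarrow> nat \<Rightarrow> 'c :: countable"
  assumes guessing_principle "A \<prec> (UNIV :: real set)"
  obtains g where "\<And>a. a \<in> A \<Longrightarrow> \<exists>n. u a n = g n"
proof -
  have "(\<lambda>a n. to_nat (u a n)) ` A \<prec> (UNIV :: real set)"
    using image_lepoll assms(2) by (rule lesspoll_trans1)
  then obtain g where g: "\<forall>f\<in>(\<lambda>a n. to_nat (u a n)) ` A. \<exists>n. f n = g n"
    using assms(1) unfolding guessing_principle_def by blast
  show thesis
  proof (rule that[of "\<lambda>n. from_nat (g n)"])
    fix a assume "a \<in> A"
    then obtain n where "to_nat (u a n) = g n" using g by auto
    then show "\<exists>n. u a n = from_nat (g n)" by (metis from_nat_to_nat)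
  qed
qed

text \<open>At stage \<open>n\<close> one guesses \<open>n + 1\<close> values of the function at once; hence one of the places
  that are spoken about has not been used at an earlier stage.\<close>

lemma guess_on_infinite_sets:
  fixes u :: "'i \<Rightarrow> nat \<Rightarrow> 'c :: countable"
  assumes gp: guessing_principle and A: "A \<prec> (UNIV :: real set)"
    and inf: "\<And>a. a \<in> A \<Longrightarrow> infinite (X a)"
  obtains g where "\<And>a. a \<in> A \<Longrightarrow> \<exists>n\<in>X a. u a n = g n"
proof -
  define v where "v a n = map (\<lambda>i. (enumerate (X a) i, u a (enumerate (X a) i))) [0..<Suc n]" for a n
  obtain g where g: "\<And>a. a \<in> A \<Longrightarrow> \<exists>n. v a n = g n"
    using guess_countable[OF gp A, of v] by blast
  define pick where "pick L n = (SOME x. x \<in> fst ` set (g n) - set L)" for L n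
  \<comment> \<open>\<open>h n\<close> lists the places chosen before stage \<open>n\<close>, so
    that the next choice can avoid them.\<close>
  define h where "h = rec_nat [] (\<lambda>n L. pick L n # L)"
  have h_simps: "h 0 = []" "h (Suc n) = pick (h n) n # h n" for n
    by (simp_all add: h_def)
  define x where "x n = pick (h n) n" for n
  have set_h: "set (h n) = x ` {..<n}" for n
    by (induction n) (auto simp: h_simps x_def lessThan_Suc)
  \<comment> \<open>At a stage where \<open>g n\<close> is a wrong table, \<open>pick\<close> may
    repeat an old place. Each place therefore takes its value from the stage that chose it
    first.\<close>
  define G where "G m = (THE c. \<exists>n. x n = m \<and> m \<notin> x ` {..<n} \<and> (m, c) \<in> set (g n))" for m
  show thesis
  proof (rule that[of G])
    fix a assume a: "a \<in> A"
    then obtain n where n: "v a n = g n" using g by blast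
    have fst_v: "fst ` set (g n) = enumerate (X a) ` {..n}"
      unfolding n[symmetric] v_def set_map set_upt image_image
      by (simp add: atLeast0LessThan lessThan_Suc_atMost)
    have "card (fst ` set (g n)) = Suc n"
      unfolding fst_v using inj_enumerate[OF inf[OF a]]
      by (subst card_image) (auto simp: inj_on_def inj_def)
    moreover have "card (set (h n)) \<le> n"
      unfolding set_h using card_image_le[of "{..<n}" x] by simp
    ultimately have "\<not> fst ` set (g n) \<subseteq> set (h n)"
      using card_mono[of "set (h n)" "fst ` set (g n)"] by auto
    then have "\<exists>y. y \<in> fst ` set (g n) - set (h n)" by blast
    then have xn: "x n \<in> fst ` set (g n) - set (h n)"
      unfolding x_def pick_def by (rule someI_ex)
    then have new: "x n \<notin> x ` {..<n}" by (simp add: set_h)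
    have X: "x n \<in> X a"
      using xn enumerate_in_set[OF inf[OF a]] unfolding fst_v by auto
    have val: "(x n, c) \<in> set (g n) \<longleftrightarrow> c = u a (x n)" for c
    proof -
      have "set (g n) = (\<lambda>y. (y, u a y)) ` enumerate (X a) ` {..n}"
        unfolding n[symmetric] v_def set_map set_upt image_image
        by (simp add: atLeast0LessThan lessThan_Suc_atMost)
      then show ?thesis using xn unfolding fst_v by blast
    qed
    have uniq: "k = n" if "x k = x n" "x n \<notin> x ` {..<k}" for k
      using that new by (metis imageI lessThan_iff linorder_neqE_nat)
    have "G (x n) = u a (x n)"
      unfolding G_def
    proof (rule the_equality)
      show "\<exists>k. x k = x n \<and> x n \<notin> x ` {..<k} \<and> (x n, u a (x n)) \<in> set (g k)"
        using new val by blast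
      fix c assume "\<exists>k. x k = x n \<and> x n \<notin> x ` {..<k} \<and> (x n, c) \<in> set (g k)"
      then obtain k where k: "x k = x n" "x n \<notin> x ` {..<k}" "(x n, c) \<in> set (g k)" by blast
      then have "(x n, c) \<in> set (g n)" using uniq[OF k(1,2)] by simp
      then show "c = u a (x n)" using val by simp
    qed
    with X show "\<exists>n\<in>X a. u a n = G n" by metis
  qed
qed

text \<open>If the inequality failed from \<open>N\<close> on, the iterates of \<open>h a\<close>
  started at \<open>j N\<close> would stay above \<open>j\<close>. But one of them equals
  \<open>g n\<close> at its own index \<open>n\<close>, and \<open>j n\<close> exceeds
  \<open>g n\<close>.\<close>

lemma guess_growth:
  fixes h :: "'i \<Rightarrow> nat \<Rightarrow> nat"
  assumes gp: guessing_principle and A: "A \<prec> (UNIV :: real set)"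
    and mono: "\<And>a. mono (h a)" and incr: "\<And>a n. n \<le> h a n"
  obtains j where "mono j" "\<And>a. a \<in> A \<Longrightarrow> infinite {n. h a (j n) \<le> j (Suc n)}"
proof -
  \<comment> \<open>The starting value \<open>j N\<close> depends on \<open>g\<close> itself, so the
    iterates from all starting values are guessed at once.\<close>
  obtain g where g: "\<And>p. p \<in> A \<times> (UNIV :: nat set) \<Longrightarrow> \<exists>n. (h (fst p) ^^ n) (snd p) = g n"
    using guess_countable[OF gp lesspoll_real_Times_nat[OF A],
        of "\<lambda>p n. (h (fst p) ^^ n) (snd p)"] by blast
  define j where "j n = (\<Sum>i\<le>n. Suc (g i))" for n
  have gj: "g n < j n" for n
    unfolding j_def using member_le_sum[of n "{..n}" "\<lambda>i. Suc (g i)"] by simp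
  have mono_j: "mono j"
    by (rule monoI) (auto simp: j_def intro!: sum_mono2)
  show thesis
  proof (rule that[OF mono_j])
    fix a assume a: "a \<in> A"
    show "infinite {n. h a (j n) \<le> j (Suc n)}"
    proof
      assume "finite {n. h a (j n) \<le> j (Suc n)}"
      then obtain N where N: "\<forall>n\<in>{n. h a (j n) \<le> j (Suc n)}. n < N"
        using finite_nat_set_iff_bounded by blast
      have late: "j (Suc n) \<le> h a (j n)" if "N \<le> n" for n
        using N that by (meson linorder_not_less mem_Collect_eq nle_le)
      \<comment> \<open>Up to \<open>N\<close>, monotonicity bounds \<open>j\<close> by
        \<open>j N\<close>; from there on, each step of \<open>j\<close> costs at most one
        application of \<open>h a\<close>.\<close>
      have "j n \<le> (h a ^^ n) (j N)" for n
      proof (induction n)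
        case 0
        then show ?case using mono_j by (simp add: monoD)
      next
        case (Suc n)
        show ?case
        proof (cases "N \<le> n")
          case True
          have "j (Suc n) \<le> h a (j n)" by (rule late[OF True])
          also have "\<dots> \<le> h a ((h a ^^ n) (j N))" by (rule monoD[OF mono Suc])
          finally show ?thesis by simp
        next
          case False
          have "j N \<le> (h a ^^ k) (j N)" for k
            by (induction k) (auto intro: order_trans[OF _ incr])
          moreover have "j (Suc n) \<le> j N" using False mono_j by (simp add: monoD)
          ultimately show ?thesis using order_trans by blast
        qed
      qed
      moreover obtain n where "(h a ^^ n) (j N) = g n" using g[of "(a, j N)"] a by auto
      ultimately show False using gj[of n] by (metis linorder_not_less)
    qed
  qed
qed

text \<open>The growth function \<open>j\<close> bounds the possible stages of the descending chain in advance,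
  so that a guess for a strategy on \<open>{..j n}\<close> can be used without knowing the chain so far.\<close>

lemma guess_chain:
  fixes \<sigma> :: "'i \<Rightarrow> nat \<Rightarrow> nat" and R :: "nat \<Rightarrow> nat \<Rightarrow> bool"
  assumes gp: guessing_principle and A: "A \<prec> (UNIV :: real set)"
    and R: "reflp R" "\<And>a m. a \<in> A \<Longrightarrow> R m (\<sigma> a m)"
  obtains c where "\<And>n. R (c n) (c (Suc n))" "\<And>a. a \<in> A \<Longrightarrow> \<exists>n. c (Suc n) = \<sigma> a (c n)"
proof -
  \<comment> \<open>The sum bounds the strategy on all positions up to \<open>n\<close>; the summand
    \<open>n\<close> supplies the growth that \<open>guess_growth\<close> asks for.\<close>
  define h where "h a n = n + (\<Sum>m\<le>n. \<sigma> a m)" for a n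
  have mono_h: "mono (h a)" for a
    by (rule monoI) (auto simp: h_def intro!: add_mono sum_mono2)
  have h_bound: "\<sigma> a m \<le> h a n" if "m \<le> n" for a m n
    unfolding h_def using member_le_sum[of m "{..n}" "\<sigma> a"] that by simp
  obtain j where j: "mono j" "\<And>a. a \<in> A \<Longrightarrow> infinite {n. h a (j n) \<le> j (Suc n)}"
    using guess_growth[OF gp A, of h] mono_h by (auto simp: h_def)
  \<comment> \<open>A correct table helps only at a stage where \<open>j\<close> leaves room for the
    answer, hence the guess on an infinite set of stages.\<close>
  obtain g where g: "\<And>a. a \<in> A \<Longrightarrow>
      \<exists>n\<in>{n. h a (j n) \<le> j (Suc n)}. map (\<sigma> a) [0..<Suc (j n)] = g n"
    using guess_on_infinite_sets[OF gp A, of "\<lambda>a. {n. h a (j n) \<le> j (Suc n)}"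
        "\<lambda>a n. map (\<sigma> a) [0..<Suc (j n)]"] j(2) by blast
  \<comment> \<open>A guess that is no legal move or exceeds the next bound is replaced by staying
    put, which reflexivity of \<open>R\<close> allows.\<close>
  define step where "step n m = (if R m (g n ! m) \<and> g n ! m \<le> j (Suc n) then g n ! m else m)" for n m
  define c where "c = rec_nat 0 step"
  have c_Suc: "c (Suc n) = step n (c n)" for n by (simp add: c_def)
  have c_bound: "c n \<le> j n" for n
  proof (induction n)
    case 0
    then show ?case by (simp add: c_def)
  next
    case (Suc n)
    then show ?case
      using monoD[OF j(1), of n "Suc n"] by (auto simp: c_Suc step_def)
  qed
  show thesis
  proof (rule that[of c])
    show "R (c n) (c (Suc n))" for n
      using R(1) by (auto simp: c_Suc step_def reflp_def)
    fix a assume a: "a \<in> A"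
    then obtain n where n: "h a (j n) \<le> j (Suc n)" "map (\<sigma> a) [0..<Suc (j n)] = g n"
      using g by blast
    have "g n ! c n = \<sigma> a (c n)"
      unfolding n(2)[symmetric] using c_bound[of n] by (subst nth_map) (auto simp del: upt_Suc)
    then have "c (Suc n) = \<sigma> a (c n)"
      using R(2)[OF a] order_trans[OF h_bound[OF c_bound] n(1)] by (simp add: c_Suc step_def)
    then show "\<exists>n. c (Suc n) = \<sigma> a (c n)" ..
  qed
qed

section \<open>Nowhere dense and meager sets\<close>

text \<open>Positions are codes of closed rational intervals, and the strategy for \<open>N\<close>
  moves to a subinterval missing \<open>N\<close>. By compactness some point lies in all intervals
  of the chain, and it avoids each \<open>N\<close> whose strategy is followed once.\<close>

lemma guess_nowhere_dense:
  assumes gp: guessing_principle and K: "K \<prec> (UNIV :: real set)"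
    and nd: "\<And>N. N \<in> K \<Longrightarrow> nowhere_dense N"
  shows "\<Union>K \<noteq> UNIV"
proof -
  define B where "B = (\<lambda>(p, q). {real_of_rat p..real_of_rat q}) ` {(p, q). p < q}"
  define b where "b = from_nat_into B"
  have "(0::rat) < 1" by simp
  then have "B \<noteq> {}" unfolding B_def by blast
  moreover have "countable B" unfolding B_def by (intro countable_image countableI_type)
  ultimately have range_b: "range b = B" unfolding b_def by (rule range_from_nat_into)
  have b_form: "\<exists>p q. p < q \<and> b m = {p..q}" for m
  proof -
    have "b m \<in> B" using range_b by blast
    then obtain p q where "p < q" "b m = {real_of_rat p..real_of_rat q}" unfolding B_def by auto
    then show ?thesis
      by (intro exI[of _ "real_of_rat p"] exI[of _ "real_of_rat q"]) (simp add: of_rat_less)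
  qed
  have shrink: "\<exists>k. b k \<subseteq> b m - N" if N: "N \<in> K" for N m
  proof -
    obtain p q where pq: "p < q" "b m = {p..q}" using b_form by blast
    have "\<not> {p<..<q} \<subseteq> closure N"
    proof
      assume "{p<..<q} \<subseteq> closure N"
      then have "{p<..<q} \<subseteq> interior (closure N)" by (simp add: interior_maximal)
      then show False using nd[OF N] dense[OF pq(1)] unfolding nowhere_dense_def by auto
    qed
    then obtain y where y: "y \<in> {p<..<q} - closure N" by blast
    \<comment> \<open>Removing the closure of \<open>N\<close> leaves an open set, which has room
      for a rational interval around \<open>y\<close>.\<close>
    have "open ({p<..<q} - closure N)" by (simp add: open_Diff)
    then obtain e where e: "e > 0" "ball y e \<subseteq> {p<..<q} - closure N"
      using y open_contains_ball by meson
    obtain r1 where r1: "y - e < real_of_rat r1" "real_of_rat r1 < y"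
      using of_rat_dense[of "y - e" y] e(1) by auto
    obtain r2 where r2: "y < real_of_rat r2" "real_of_rat r2 < y + e"
      using of_rat_dense[of y "y + e"] e(1) by auto
    have "real_of_rat r1 < real_of_rat r2" using r1 r2 by linarith
    then have "{real_of_rat r1..real_of_rat r2} \<in> B"
      unfolding B_def by (auto simp: of_rat_less)
    then obtain k where k: "b k = {real_of_rat r1..real_of_rat r2}"
      using range_b by (metis imageE)
    have "{real_of_rat r1..real_of_rat r2} \<subseteq> ball y e"
      using r1 r2 by (auto simp: dist_real_def)
    then show ?thesis
      using e(2) pq(2) k closure_subset[of N] greaterThanLessThan_subseteq_atLeastAtMost_iff[of p q p q]
      by (intro exI[of _ k]) auto
  qed
  define \<sigma> where "\<sigma> N m = (SOME k. b k \<subseteq> b m - N)" for N m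
  have \<sigma>: "b (\<sigma> N m) \<subseteq> b m - N" if "N \<in> K" for N m
    unfolding \<sigma>_def using shrink[OF that] by (rule someI_ex)
  obtain c where c: "\<And>n. b (c (Suc n)) \<subseteq> b (c n)"
      "\<And>N. N \<in> K \<Longrightarrow> \<exists>n. c (Suc n) = \<sigma> N (c n)"
  proof (rule guess_chain[OF gp K, of "\<lambda>m k. b k \<subseteq> b m" \<sigma>])
    show "reflp (\<lambda>m k. b k \<subseteq> b m)" by (simp add: reflp_def)
    show "b (\<sigma> N m) \<subseteq> b m" if "N \<in> K" for N m using \<sigma>[OF that] by blast
  qed blast
  have "(\<Inter>n. b (c n)) \<noteq> {}"
  proof (rule compact_nest)
    show "compact (b (c n))" "b (c n) \<noteq> {}" for n
      using b_form[of "c n"] by auto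
    show "b (c n) \<subseteq> b (c m)" if "m \<le> n" for m n
      using lift_Suc_antimono_le[of "\<lambda>n. b (c n)", OF c(1) that] .
  qed
  then obtain y where y: "\<And>n. y \<in> b (c n)" by blast
  have "y \<notin> N" if "N \<in> K" for N
    using c(2)[OF that] \<sigma>[OF that] y by (metis DiffE subsetD)
  then show ?thesis by blast
qed

text \<open>Splitting each meager set into countably many nowhere dense ones keeps the cover below
  the continuum.\<close>

lemma covM_less_continuum_imp_not_guessing:
  assumes covM_less_continuum
  shows "\<not> guessing_principle"
proof
  assume gp: guessing_principle
  obtain F :: "real set set" where F: "\<And>A. A \<in> F \<Longrightarrow> meager A" "\<Union>F = UNIV" "F \<prec> (UNIV :: real set)"
    using assms unfolding covM_less_continuum_def by blast
  obtain \<N> where \<N>: "\<And>A. A \<in> F \<Longrightarrow> countable (\<N> A) \<and> (\<forall>N\<in>\<N> A. nowhere_dense N) \<and> A \<subseteq> \<Union>(\<N> A)"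
    using F(1) unfolding meager_def by metis
  define K where "K = (\<Union>A\<in>F. \<N> A)"
  have "K \<subseteq> (\<lambda>(A, n). from_nat_into (\<N> A) n) ` (F \<times> UNIV)"
  proof
    fix N assume "N \<in> K"
    then obtain A where A: "A \<in> F" "N \<in> \<N> A" unfolding K_def by blast
    then obtain n where "from_nat_into (\<N> A) n = N"
      using \<N> from_nat_into_surj by metis
    then show "N \<in> (\<lambda>(A, n). from_nat_into (\<N> A) n) ` (F \<times> UNIV)" using A(1) by force
  qed
  then have "K \<lesssim> F \<times> (UNIV :: nat set)"
    using subset_imp_lepoll lepoll_trans[OF _ image_lepoll] by metis
  then have "K \<prec> (UNIV :: real set)"
    using lesspoll_real_Times_nat[OF F(3)] lesspoll_trans1 by blast
  then have "\<Union>K \<noteq> UNIV"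
    using \<N> by (intro guess_nowhere_dense[OF gp]) (auto simp: K_def)
  moreover have "\<Union>K = UNIV" using F(2) \<N> unfolding K_def by blast
  ultimately show False by simp
qed

section \<open>An ultrametric on sequences\<close>

text \<open>The exponent \<open>1 / s\<close> makes the \<open>s\<close>-th power of a distance
  \<open>1 / (1 + k)\<close>, with \<open>k\<close> the first place of difference. This matches the
  bound on the terms of a decreasing series with sum below 1.\<close>

definition branch_dist :: "real \<Rightarrow> (nat \<Rightarrow> nat) \<Rightarrow> (nat \<Rightarrow> nat) \<Rightarrow> real" where
  "branch_dist s x y =
     (if x = y then 0 else (1 / (1 + real (LEAST k. x k \<noteq> y k))) powr (1 / s))"

lemma branch_dist_nonneg: "0 \<le> branch_dist s x y"
  by (simp add: branch_dist_def)

lemma branch_dist_commute: "branch_dist s x y = branch_dist s y x"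
  unfolding branch_dist_def by (simp add: eq_commute)

lemma branch_dist_eq_0_iff: "branch_dist s x y = 0 \<longleftrightarrow> x = y"
  by (simp add: branch_dist_def)

lemma branch_dist_le:
  assumes "s > 0" "\<And>i. i < k \<Longrightarrow> x i = y i"
  shows "branch_dist s x y \<le> (1 / (1 + real k)) powr (1 / s)"
proof (cases "x = y")
  case False
  then have "\<exists>i. x i \<noteq> y i" by auto
  then have "x (LEAST i. x i \<noteq> y i) \<noteq> y (LEAST i. x i \<noteq> y i)" by (rule LeastI_ex)
  then have "k \<le> (LEAST i. x i \<noteq> y i)" using assms(2) by (meson linorder_not_less)
  then show ?thesis
    using False assms(1) by (auto simp: branch_dist_def intro!: powr_mono2 divide_left_mono)
qed (simp add: branch_dist_def)

lemma branch_dist_ge: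
  assumes "s > 0" "x k \<noteq> y k"
  shows "(1 / (1 + real k)) powr (1 / s) \<le> branch_dist s x y"
proof -
  have "(LEAST i. x i \<noteq> y i) \<le> k" using assms(2) by (rule Least_le)
  moreover have "x \<noteq> y" using assms(2) by auto
  ultimately show ?thesis
    using assms(1) by (auto simp: branch_dist_def intro!: powr_mono2 divide_left_mono)
qed

lemma branch_dist_le_1: "s > 0 \<Longrightarrow> branch_dist s x y \<le> 1"
  using branch_dist_le[of s 0 x y] by simp

text \<open>At the first place where \<open>x\<close> and \<open>z\<close> differ, \<open>y\<close>
  differs from one of them.\<close>

lemma branch_dist_ultrametric:
  assumes "s > 0"
  shows "branch_dist s x z \<le> max (branch_dist s x y) (branch_dist s y z)"
proof (cases "x = z")
  case True
  then show ?thesis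
    by (simp add: branch_dist_eq_0_iff[THEN iffD2] branch_dist_nonneg le_max_iff_disj)
next
  case False
  define k where "k = (LEAST i. x i \<noteq> z i)"
  have d: "branch_dist s x z = (1 / (1 + real k)) powr (1 / s)"
    using False by (simp add: branch_dist_def k_def)
  have "\<exists>i. x i \<noteq> z i" using False by auto
  then have "x k \<noteq> z k" unfolding k_def by (rule LeastI_ex)
  then have "x k \<noteq> y k \<or> y k \<noteq> z k" by auto
  then show ?thesis
    using branch_dist_ge[OF assms] unfolding d le_max_iff_disj by blast
qed

lemma Metric_space_branch_dist:
  assumes "s > 0" "inj_on e M"
  shows "Metric_space M (\<lambda>a b. branch_dist s (e a) (e b))"
proof
  fix a b c
  show "0 \<le> branch_dist s (e a) (e b)" by (rule branch_dist_nonneg)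
  show "branch_dist s (e a) (e b) = branch_dist s (e b) (e a)" by (rule branch_dist_commute)
  show "branch_dist s (e a) (e b) = 0 \<longleftrightarrow> a = b" if "a \<in> M" "b \<in> M"
    using that assms(2) by (simp add: branch_dist_eq_0_iff inj_on_eq_iff)
  show "branch_dist s (e a) (e c) \<le> branch_dist s (e a) (e b) + branch_dist s (e b) (e c)"
    using branch_dist_ultrametric[OF assms(1), of "e a" "e c" "e b"]
      branch_dist_nonneg[of s "e a" "e b"] branch_dist_nonneg[of s "e b" "e c"] by linarith
qed

text \<open>The points are labels that \<open>e\<close> reads as sequences, so that the space can be
  carried by a set of reals.\<close>

definition branch_metric :: "real \<Rightarrow> ('a \<Rightarrow> nat \<Rightarrow> nat) \<Rightarrow> 'a set \<Rightarrow> 'a metric" where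
  "branch_metric s e M = metric (M, \<lambda>a b. branch_dist s (e a) (e b))"

lemma
  assumes "s > 0" "inj_on e M"
  shows mspace_branch_metric: "mspace (branch_metric s e M) = M"
    and mdist_branch_metric: "mdist (branch_metric s e M) a b = branch_dist s (e a) (e b)"
  using Metric_space.mspace_metric[OF Metric_space_branch_dist[OF assms]]
    Metric_space.mdist_metric[OF Metric_space_branch_dist[OF assms]]
  by (simp_all add: branch_metric_def)

text \<open>One point is chosen for each finite initial segment that occurs. There are countably
  many segments, and points sharing a long one are close.\<close>

lemma separable_branch_metric:
  assumes s: "s > 0" and e: "inj_on e M"
  shows "separable_space (mtopology_of (branch_metric s e M))"
proof -
  interpret Metric_space M "\<lambda>a b. branch_dist s (e a) (e b)"
    by (rule Metric_space_branch_dist[OF s e])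
  define rep where "rep p = (SOME a. a \<in> M \<and> map (e a) [0..<length p] = p)" for p
  define C where "C = rep ` {p. \<exists>a\<in>M. map (e a) [0..<length p] = p}"
  have rep: "rep p \<in> M \<and> map (e (rep p)) [0..<length p] = p"
    if "\<exists>a\<in>M. map (e a) [0..<length p] = p" for p
    unfolding rep_def by (rule someI_ex) (use that in blast)
  have "countable C" unfolding C_def by (intro countable_image countableI_type)
  moreover have CM: "C \<subseteq> M" unfolding C_def using rep by blast
  moreover have "a \<in> mtopology closure_of C" if a: "a \<in> M" for a
    unfolding metric_closure_of
  proof (clarify, intro conjI allI impI)
    fix r :: real assume r: "0 < r"
    have "(\<lambda>k. (1 / (1 + real k)) powr (1 / s)) \<longlonglongrightarrow> 0"
      using s by real_asymp
    then have "\<forall>\<^sub>F k in sequentially. (1 / (1 + real k)) powr (1 / s) < r"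
      using r by (rule order_tendstoD)
    then obtain k where k: "(1 / (1 + real k)) powr (1 / s) < r"
      using eventually_happens'[OF sequentially_bot] by blast
    define p where "p = map (e a) [0..<k]"
    have p: "\<exists>a\<in>M. map (e a) [0..<length p] = p" using a by (auto simp: p_def)
    then have rp: "rep p \<in> M" "map (e (rep p)) [0..<k] = map (e a) [0..<k]"
      using rep[OF p] by (simp_all add: p_def)
    then have "e a i = e (rep p) i" if "i < k" for i using that by auto
    then have "branch_dist s (e a) (e (rep p)) < r"
      using branch_dist_le[OF s] k by (meson order_le_less_trans)
    moreover have "rep p \<in> C" using p unfolding C_def by blast
    ultimately show "\<exists>y\<in>C. y \<in> mball a r" using a rp(1) by auto
  qed (rule a)
  then have "mtopology closure_of C = M"
    using closure_of_subset_topspace[of mtopology C] by auto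
  ultimately show ?thesis
    unfolding separable_space_def branch_metric_def mtopology_of
    by (intro exI[of _ C]) simp
qed

section \<open>Hausdorff dimension\<close>

text \<open>\<open>r i\<close> counts the indices before \<open>i\<close> in the order of decreasing
  weight, ties broken by index. These and \<open>i\<close> itself all weigh at least
  \<open>w i\<close>, so \<open>(1 + r i) * w i\<close> is below 1. Positive weights make the ranks
  finite.\<close>

lemma rank_injection:
  fixes w :: "nat \<Rightarrow> real"
  assumes pos: "\<And>i. 0 < w i" and bound: "\<And>T. finite T \<Longrightarrow> sum w T < 1"
  obtains r :: "nat \<Rightarrow> nat" where "inj r" "\<And>i. w i < 1 / (1 + real (r i))"
proof -
  define S where "S i = {j. w i < w j \<or> w j = w i \<and> j < i}" for i
  have count: "real (card T) * w i < 1" if "finite T" "T \<subseteq> insert i (S i)" for T i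
  proof -
    have "real (card T) * w i = (\<Sum>j\<in>T. w i)" by simp
    also have "\<dots> \<le> sum w T" using that(2) by (intro sum_mono) (auto simp: S_def)
    finally show ?thesis using bound[OF that(1)] by simp
  qed
  have fin: "finite (S i)" for i
  proof (rule ccontr)
    assume "infinite (S i)"
    obtain n where n: "1 < real n * w i" using reals_Archimedean3[OF pos] by blast
    obtain T where "T \<subseteq> S i" "finite T" "card T = n"
      using infinite_arbitrarily_large[OF \<open>infinite (S i)\<close>] by blast
    then show False using count[of T i] n by auto
  qed
  define r where "r i = card (S i)" for i
  have "w i < 1 / (1 + real (r i))" for i
  proof -
    have "i \<notin> S i" by (simp add: S_def)
    then have "real (card (insert i (S i))) = 1 + real (r i)" using fin by (simp add: r_def)
    then have "(1 + real (r i)) * w i < 1" using count[of "insert i (S i)" i] fin by simp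
    then show ?thesis by (simp add: field_simps)
  qed
  moreover have less: "r i < r j" if "i \<in> S j" for i j
    unfolding r_def
  proof (rule psubset_card_mono[OF fin])
    show "S i \<subset> S j" using that by (auto simp: S_def)
  qed
  have "inj r"
  proof (rule injI, rule ccontr)
    fix i j assume "r i = r j" "i \<noteq> j"
    moreover from \<open>i \<noteq> j\<close> have "i \<in> S j \<or> j \<in> S i" by (auto simp: S_def)
    ultimately show False using less by (metis less_irrefl)
  qed
  ultimately show thesis using that by blast
qed

text \<open>If the measure vanished for some \<open>t < s\<close>, a cover with small sum would
  exist. All points of \<open>U i\<close> then agree at place \<open>r i\<close>, and since these
  places are distinct, one \<open>g\<close> would meet every point, against
  \<open>evasive\<close>.\<close>

lemma hausdorff_dim_branch_metric:
  assumes s: "s > 0" and e: "inj_on e M"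
    and evasive: "\<And>g. \<exists>a\<in>M. \<forall>n. e a n \<noteq> g n"
  shows "ereal s \<le> hausdorff_dim (branch_metric s e M)"
  unfolding hausdorff_dim_def
proof (rule Inf_greatest, clarsimp simp: mspace_branch_metric[OF s e])
  fix t :: real
  let ?m = "branch_metric s e M"
  note [simp] = mspace_branch_metric[OF s e] mdist_branch_metric[OF s e]
  assume t: "0 < t" and null: "hausdorff_measure ?m t M = 0"
  show "s \<le> t"
  proof (rule ccontr)
    assume "\<not> s \<le> t"
    \<comment> \<open>All distances are at most 1, so scale 1 restricts nothing and only the small
      sum matters. The bound 1/2 leaves the other half for the summands that make the weights
      positive.\<close>
    have "hausdorff_pre ?m t 1 M \<le> hausdorff_measure ?m t M"
      unfolding hausdorff_measure_def by (intro SUP_upper) simp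
    then have "hausdorff_pre ?m t 1 M < ennreal (1 / 2)"
      unfolding null using ennreal_less_iff[of 0 "1 / 2"] by (auto intro: le_less_trans)
    then obtain U :: "nat \<Rightarrow> 'a set" where U: "M \<subseteq> (\<Union>n. U n)" "\<And>n. U n \<subseteq> M"
        and sumU: "(\<Sum>n. ennreal (hdiam ?m (U n) powr t)) < ennreal (1 / 2)"
      unfolding hausdorff_pre_def Inf_less_iff by auto
    have diam: "branch_dist s (e a) (e b) \<le> hdiam ?m (U i)" if "a \<in> U i" "b \<in> U i" for a b i
    proof -
      have "bdd_above {mdist ?m x y | x y. x \<in> U i \<and> y \<in> U i}"
        using branch_dist_le_1[OF s] by (intro bdd_aboveI[of _ 1]) auto
      then have "mdist ?m a b \<le> Sup {mdist ?m x y | x y. x \<in> U i \<and> y \<in> U i}"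
        using that by (intro cSup_upper) auto
      then show ?thesis using that by (auto simp: hdiam_def)
    qed
    \<comment> \<open>The summand \<open>(1/2)^i / 4\<close> makes the weights positive, as the ranking requires.\<close>
    define w where "w i = hdiam ?m (U i) powr t + (1 / 2) ^ i / 4" for i
    have w_pos: "0 < w i" for i unfolding w_def by (intro add_nonneg_pos) auto
    have w_sum: "sum w T < 1" if T: "finite T" for T
    proof -
      have "ennreal (\<Sum>i\<in>T. hdiam ?m (U i) powr t) = (\<Sum>i\<in>T. ennreal (hdiam ?m (U i) powr t))"
        by (simp add: sum_ennreal)
      also have "\<dots> \<le> (\<Sum>n. ennreal (hdiam ?m (U n) powr t))"
        using T by (intro sum_le_suminf) auto
      also note sumU
      finally have "(\<Sum>i\<in>T. hdiam ?m (U i) powr t) < 1 / 2"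
        using ennreal_less_iff[OF sum_nonneg, of T "\<lambda>i. hdiam ?m (U i) powr t" "1 / 2"] by simp
      moreover have "(\<Sum>i\<in>T. (1 / 2 :: real) ^ i) \<le> (\<Sum>i. (1 / 2) ^ i)"
        using T by (intro sum_le_suminf summable_geometric) auto
      then have "(\<Sum>i\<in>T. (1 / 2 :: real) ^ i / 4) \<le> 1 / 2"
        by (simp add: suminf_geometric flip: sum_divide_distrib)
      ultimately show ?thesis by (simp add: w_def sum.distrib)
    qed
    obtain r where r: "inj r" "\<And>i. w i < 1 / (1 + real (r i))"
      using rank_injection[of w] w_pos w_sum by blast
    have const: "e a (r i) = e b (r i)" if ab: "a \<in> U i" "b \<in> U i" for a b i
    proof (rule ccontr)
      assume "e a (r i) \<noteq> e b (r i)"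
      then have *: "(1 / (1 + real (r i))) powr (1 / s) \<le> branch_dist s (e a) (e b)"
        by (rule branch_dist_ge[OF s])
      \<comment> \<open>Lowering the exponent from \<open>s\<close> to \<open>t\<close> can only
        enlarge the power, because distances are at most 1.\<close>
      have "1 / (1 + real (r i)) = ((1 / (1 + real (r i))) powr (1 / s)) powr s"
        using s by (simp add: powr_powr)
      also have "\<dots> \<le> branch_dist s (e a) (e b) powr s"
        using * s by (intro powr_mono2) auto
      also have "\<dots> \<le> branch_dist s (e a) (e b) powr t"
        using branch_dist_le_1[OF s] branch_dist_nonneg \<open>\<not> s \<le> t\<close> by (intro powr_mono') auto
      also have "\<dots> \<le> hdiam ?m (U i) powr t"
        using diam[OF ab] t branch_dist_nonneg by (intro powr_mono2) auto
      also have "\<dots> < w i" by (simp add: w_def)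
      finally show False using r(2)[of i] by simp
    qed
    \<comment> \<open>At place \<open>r i\<close>, \<open>g\<close> copies some member of
      \<open>U i\<close>. Off the range of \<open>r\<close>, and where \<open>U i\<close> is empty,
      its value is arbitrary.\<close>
    define g where "g n = e (SOME a. a \<in> U (inv r n)) n" for n
    obtain a where a: "a \<in> M" "\<And>n. e a n \<noteq> g n" using evasive by blast
    then obtain i where i: "a \<in> U i" using U(1) by blast
    then have "(SOME a. a \<in> U i) \<in> U i" by (rule someI)
    then have "g (r i) = e a (r i)"
      unfolding g_def using const[OF _ i] r(1) by simp
    then show False using a(2) by metis
  qed
qed

section \<open>Intervals and the conclusion\<close>

text \<open>A rescaled arctangent injects the line into the segment between \<open>x\<close> and
  \<open>y\<close>.\<close>

lemma real_lepoll_interval: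
  fixes I :: "real set"
  assumes "is_interval I" "x \<in> I" "y \<in> I" "x \<noteq> y"
  shows "(UNIV :: real set) \<lesssim> I"
proof -
  define a b where "a = min x y" and "b = max x y"
  have ab: "a < b" "a \<in> I" "b \<in> I" using assms by (auto simp: a_def b_def min_def max_def)
  define f where "f u = a + (b - a) * (1 / 2 + arctan u / pi)" for u
  have "inj f" using ab(1) by (auto simp: inj_def f_def arctan_eq_iff)
  moreover have "f u \<in> I" for u
  proof -
    have "0 < 1 / 2 + arctan u / pi" "1 / 2 + arctan u / pi < 1"
      using arctan_bounded[of u] pi_gt_zero by (simp_all add: field_simps)
    then have "0 \<le> (b - a) * (1 / 2 + arctan u / pi)" "(b - a) * (1 / 2 + arctan u / pi) \<le> b - a"
      using ab(1) by (auto intro!: mult_nonneg_nonneg mult_left_le simp del: distrib_left)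
    then have "a \<le> f u" "f u \<le> b"
      unfolding f_def by linarith+
    then show ?thesis using mem_is_interval_1_I[OF assms(1) ab(2,3)] by blast
  qed
  ultimately show ?thesis unfolding lepoll_def by blast
qed

theorem theorem3p3:
  assumes "covM_less_continuum"
  shows "\<forall>s::real. s > 0 \<longrightarrow>
    (\<exists>m :: real metric.
        separable_space (mtopology_of m) \<and>
        hausdorff_dim m \<ge> ereal s \<and>
        mspace m \<prec> (UNIV :: real set) \<and>
        (\<forall>(f :: real \<Rightarrow> real) (I :: real set).
            is_interval I \<and> (\<exists>x\<in>I. \<exists>y\<in>I. x \<noteq> y) \<longrightarrow> f ` mspace m \<noteq> I))"
proof (intro allI impI)
  fix s :: real assume s: "s > 0"
  obtain F :: "(nat \<Rightarrow> nat) set" where F: "F \<prec> (UNIV :: real set)" "\<And>g. \<exists>f\<in>F. \<forall>n. f n \<noteq> g n"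
    using covM_less_continuum_imp_not_guessing[OF assms] unfolding guessing_principle_def by metis
  obtain \<iota> :: "(nat \<Rightarrow> nat) \<Rightarrow> real" where \<iota>: "inj_on \<iota> F"
    using F(1) unfolding lesspoll_def lepoll_def by blast
  \<comment> \<open>The evasive family is copied into the reals, where the space has to live, and
    \<open>e\<close> decodes it.\<close>
  define M where "M = \<iota> ` F"
  define e where "e = inv_into F \<iota>"
  have e: "inj_on e M" unfolding e_def M_def by (rule inj_on_inv_into) simp
  have "M \<prec> (UNIV :: real set)"
    unfolding M_def using image_lepoll F(1) by (rule lesspoll_trans1)
  then have M: "mspace (branch_metric s e M) \<prec> (UNIV :: real set)"
    by (simp add: mspace_branch_metric[OF s e])
  have evasive: "\<exists>a\<in>M. \<forall>n. e a n \<noteq> g n" for g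
    using F(2)[of g] \<iota> by (auto simp: M_def e_def)
  \<comment> \<open>An image is no larger than its source, whereas a non-degenerate interval has the
    size of the continuum.\<close>
  have "f ` mspace (branch_metric s e M) \<noteq> I"
    if "is_interval I" "x \<in> I" "y \<in> I" "x \<noteq> y" for f :: "real \<Rightarrow> real" and I x y
  proof
    assume "f ` mspace (branch_metric s e M) = I"
    then have "I \<lesssim> mspace (branch_metric s e M)" using image_lepoll by metis
    then have "(UNIV :: real set) \<lesssim> mspace (branch_metric s e M)"
      using real_lepoll_interval[OF that] lepoll_trans by blast
    then show False using M lesspoll_trans1 by blast
  qed
  then show "\<exists>m :: real metric. separable_space (mtopology_of m) \<and> hausdorff_dim m \<ge> ereal s \<and>
      mspace m \<prec> (UNIV :: real set) \<and>
      (\<forall>(f :: real \<Rightarrow> real) (I :: real set).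
          is_interval I \<and> (\<exists>x\<in>I. \<exists>y\<in>I. x \<noteq> y) \<longrightarrow> f ` mspace m \<noteq> I)"
    using separable_branch_metric[OF s e] hausdorff_dim_branch_metric[OF s e evasive] M by blast
qed

end
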